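(* Let $f$ be a nonnegative continuous function on $\mathbb{Q}_p^N\setminus\{0\}$ defining a positive-definite distribution, with $f=\mathcal{F}\mu$ for a regular Borel measure $\mu$ on $\mathbb{Q}_p^N$, and let $d\ge1$ be an integer and $\beta>0$. Then \[ \int_{\mathbb{Q}_p^N}\frac{d\mu(\xi)}{\max(1,\|\xi\|_p)^{d\beta}}<+\infty \] if and only if \[ \begin{cases} \dfrac{1-p^{-d\beta}}{1-p^{d\beta-N}}\displaystyle\int_{\|x\|_p\le1}\left(\|x\|_p^{d\beta-N}-p^{d\beta-N}\right)f(x)\,d^Nx<+\infty & \text{if } d\beta\ne N,\\[2ex] (1-p^{-N})\displaystyle\int_{\|x\|_p\le1}\log_p\left(\frac{p}{\|x\|_p}\right)f(x)\,d^Nx<+\infty & \text{if } d\beta=N. \end{cases} \]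
   Context: $p$ is a prime, $\mathbb{Q}_p$ the $p$-adic numbers, $\|x\|_p=\max_i|x_i|_p$ on $\mathbb{Q}_p^N$, $d^Nx$ Haar measure with $\mathbb{Z}_p^N$ of measure 1. Fourier transform $(\mathcal{F}\varphi)(\xi)=\int\chi_p(-\xi\cdot x)\varphi(x)d^Nx$ with $\chi_p(y)=\exp(2\pi i\{y\}_p)$, extended to distributions (and measures) by duality on the space of locally constant compactly supported test functions. A distribution $F$ is positive-definite if $(F,\overline{\varphi*\widetilde\varphi})\ge0$ for all test functions $\varphi$, where $\widetilde\varphi(x)=\overline{\varphi(-x)}$. *)

theory Defs
  imports "HOL-Analysis.Analysis" "HOL-Computational_Algebra.Primes"
begin

text \<open>Concrete model of the p-adic numbers: an element of Q_p is its canonical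
  p-adic digit expansion a, i.e. x = sum over i of a i * p^i, with digits in
  0..p-1 and only finitely many nonzero digits of negative index.
  An element of Q_p^N is a function c |-> x c (components c < N), padded by zero.\<close>

definition Qp :: "nat \<Rightarrow> (int \<Rightarrow> int) set" where
  "Qp p = {a. (\<forall>i. 0 \<le> a i \<and> a i < int p) \<and> (\<exists>n. \<forall>i<n. a i = 0)}"

definition QpN :: "nat \<Rightarrow> nat \<Rightarrow> (nat \<Rightarrow> int \<Rightarrow> int) set" where
  "QpN p N = {x. (\<forall>c<N. x c \<in> Qp p) \<and> (\<forall>c\<ge>N. x c = (\<lambda>_. 0))}"

definition zeroQ :: "nat \<Rightarrow> int \<Rightarrow> int" where
  "zeroQ = (\<lambda>c i. 0)"

definition ordQ :: "(int \<Rightarrow> int) \<Rightarrow> int" where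
  "ordQ a = (THE i. a i \<noteq> 0 \<and> (\<forall>j<i. a j = 0))"

definition absQ :: "nat \<Rightarrow> (int \<Rightarrow> int) \<Rightarrow> real" where
  "absQ p a = (if (\<forall>i. a i = 0) then 0 else real p powr (- real_of_int (ordQ a)))"

definition normQ :: "nat \<Rightarrow> nat \<Rightarrow> (nat \<Rightarrow> int \<Rightarrow> int) \<Rightarrow> real" where
  "normQ p N x = Max (insert 0 {absQ p (x c) | c. c < N})"

text \<open>Closed ball of radius p^(-k) around x: all digits of index < k agree.\<close>
definition ballQ :: "nat \<Rightarrow> nat \<Rightarrow> (nat \<Rightarrow> int \<Rightarrow> int) \<Rightarrow> int \<Rightarrow> (nat \<Rightarrow> int \<Rightarrow> int) set" where
  "ballQ p N x k = {y \<in> QpN p N. \<forall>c<N. \<forall>i<k. y c i = x c i}"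

definition openQ :: "nat \<Rightarrow> nat \<Rightarrow> (nat \<Rightarrow> int \<Rightarrow> int) set \<Rightarrow> bool" where
  "openQ p N U \<longleftrightarrow> U \<subseteq> QpN p N \<and> (\<forall>x\<in>U. \<exists>k. ballQ p N x k \<subseteq> U)"

definition compactQ :: "nat \<Rightarrow> nat \<Rightarrow> (nat \<Rightarrow> int \<Rightarrow> int) set \<Rightarrow> bool" where
  "compactQ p N K \<longleftrightarrow> K \<subseteq> QpN p N \<and>
     (\<forall>\<U>. (\<forall>U\<in>\<U>. openQ p N U) \<and> K \<subseteq> \<Union>\<U> \<longrightarrow> (\<exists>\<V>\<subseteq>\<U>. finite \<V> \<and> K \<subseteq> \<Union>\<V>))"

text \<open>Borel sigma-algebra (generated by the balls, which form a basis of the topology).\<close>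
definition borelQ :: "nat \<Rightarrow> nat \<Rightarrow> (nat \<Rightarrow> int \<Rightarrow> int) measure" where
  "borelQ p N = sigma (QpN p N) {ballQ p N x k | x k. x \<in> QpN p N}"

text \<open>Haar measure, normalised by mu(Z_p^N) = 1: push-forward of Lebesgue measure on
  [0,oo)^N under the (Monna-type) digit map t |-> (i |-> floor(t p^(i+1)) mod p).\<close>
definition digitQ :: "nat \<Rightarrow> real \<Rightarrow> int \<Rightarrow> int" where
  "digitQ p t = (\<lambda>i. \<lfloor>t * real p powr real_of_int (i + 1)\<rfloor> mod int p)"

definition haarQ :: "nat \<Rightarrow> nat \<Rightarrow> (nat \<Rightarrow> int \<Rightarrow> int) measure" where
  "haarQ p N = distr (PiM {..<N} (\<lambda>_. restrict_space lborel {0::real..})) (borelQ p N)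
      (\<lambda>y c. if c < N then digitQ p (y c) else (\<lambda>_. 0))"

definition lowbQ :: "(int \<Rightarrow> int) \<Rightarrow> nat" where
  "lowbQ a = (LEAST n::nat. \<forall>i < - int n. a i = 0)"

definition truncQ :: "nat \<Rightarrow> int \<Rightarrow> (int \<Rightarrow> int) \<Rightarrow> real" where
  "truncQ p k a = (\<Sum>j\<in>{- int (lowbQ a)..<k}. real_of_int (a j) * real p powr real_of_int j)"

definition subQ :: "nat \<Rightarrow> (int \<Rightarrow> int) \<Rightarrow> (int \<Rightarrow> int) \<Rightarrow> (int \<Rightarrow> int)" where
  "subQ p a b = (\<lambda>i. \<lfloor>(truncQ p (i + 1) a - truncQ p (i + 1) b) / real p powr real_of_int i\<rfloor> mod int p)"

definition subvQ :: "nat \<Rightarrow> nat \<Rightarrow> (nat \<Rightarrow> int \<Rightarrow> int) \<Rightarrow> (nat \<Rightarrow> int \<Rightarrow> int) \<Rightarrow> (nat \<Rightarrow> int \<Rightarrow> int)" where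
  "subvQ p N x y = (\<lambda>c. if c < N then subQ p (x c) (y c) else (\<lambda>_. 0))"

text \<open>A real number congruent to the product a*b modulo Z_p, hence
  exp(2 pi i pairQ a b) = chi_p(a b).\<close>
definition pairQ :: "nat \<Rightarrow> (int \<Rightarrow> int) \<Rightarrow> (int \<Rightarrow> int) \<Rightarrow> real" where
  "pairQ p a b = (let K = int (max (lowbQ a) (lowbQ b)) in truncQ p K a * truncQ p K b)"

definition chiQ :: "nat \<Rightarrow> nat \<Rightarrow> (nat \<Rightarrow> int \<Rightarrow> int) \<Rightarrow> (nat \<Rightarrow> int \<Rightarrow> int) \<Rightarrow> complex" where
  "chiQ p N \<xi> x = exp (- (2 * pi * \<i>) * complex_of_real (\<Sum>c<N. pairQ p (\<xi> c) (x c)))"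

definition fourierQ :: "nat \<Rightarrow> nat \<Rightarrow> ((nat \<Rightarrow> int \<Rightarrow> int) \<Rightarrow> complex) \<Rightarrow> (nat \<Rightarrow> int \<Rightarrow> int) \<Rightarrow> complex" where
  "fourierQ p N \<phi> \<xi> = integral\<^sup>L (haarQ p N) (\<lambda>x. chiQ p N \<xi> x * \<phi> x)"

definition testfunQ :: "nat \<Rightarrow> nat \<Rightarrow> ((nat \<Rightarrow> int \<Rightarrow> int) \<Rightarrow> complex) \<Rightarrow> bool" where
  "testfunQ p N \<phi> \<longleftrightarrow>
     (\<forall>x\<in>QpN p N. \<exists>k. \<forall>y\<in>ballQ p N x k. \<phi> y = \<phi> x) \<and>
     (\<exists>K. compactQ p N K \<and> {x\<in>QpN p N. \<phi> x \<noteq> 0} \<subseteq> K)"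

definition convQ :: "nat \<Rightarrow> nat \<Rightarrow> ((nat \<Rightarrow> int \<Rightarrow> int) \<Rightarrow> complex) \<Rightarrow> ((nat \<Rightarrow> int \<Rightarrow> int) \<Rightarrow> complex)
    \<Rightarrow> (nat \<Rightarrow> int \<Rightarrow> int) \<Rightarrow> complex" where
  "convQ p N \<phi> \<psi> x = integral\<^sup>L (haarQ p N) (\<lambda>y. \<phi> y * \<psi> (subvQ p N x y))"

definition tildeQ :: "nat \<Rightarrow> nat \<Rightarrow> ((nat \<Rightarrow> int \<Rightarrow> int) \<Rightarrow> complex) \<Rightarrow> (nat \<Rightarrow> int \<Rightarrow> int) \<Rightarrow> complex" where
  "tildeQ p N \<phi> x = cnj (\<phi> (subvQ p N zeroQ x))"

definition contQ :: "nat \<Rightarrow> nat \<Rightarrow> ((nat \<Rightarrow> int \<Rightarrow> int) \<Rightarrow> real) \<Rightarrow> bool" where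
  "contQ p N f \<longleftrightarrow> (\<forall>x\<in>QpN p N - {zeroQ}. \<forall>\<epsilon>>0. \<exists>k. \<forall>y\<in>ballQ p N x k - {zeroQ}. \<bar>f y - f x\<bar> < \<epsilon>)"

text \<open>f is locally integrable, so it defines a distribution phi |-> int f phi.\<close>
definition locintQ :: "nat \<Rightarrow> nat \<Rightarrow> ((nat \<Rightarrow> int \<Rightarrow> int) \<Rightarrow> real) \<Rightarrow> bool" where
  "locintQ p N f \<longleftrightarrow> (\<forall>K. compactQ p N K \<longrightarrow> set_integrable (haarQ p N) K f)"

definition posdefQ :: "nat \<Rightarrow> nat \<Rightarrow> ((nat \<Rightarrow> int \<Rightarrow> int) \<Rightarrow> real) \<Rightarrow> bool" where
  "posdefQ p N f \<longleftrightarrow> (\<forall>\<phi>. testfunQ p N \<phi> \<longrightarrow>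
     (let z = integral\<^sup>L (haarQ p N) (\<lambda>x. complex_of_real (f x) * cnj (convQ p N \<phi> (tildeQ p N \<phi>) x))
      in Im z = 0 \<and> 0 \<le> Re z))"

definition regular_borelQ :: "nat \<Rightarrow> nat \<Rightarrow> (nat \<Rightarrow> int \<Rightarrow> int) measure \<Rightarrow> bool" where
  "regular_borelQ p N \<mu> \<longleftrightarrow> sets \<mu> = sets (borelQ p N) \<and>
     (\<forall>K. compactQ p N K \<longrightarrow> emeasure \<mu> K < \<infinity>) \<and>
     (\<forall>A\<in>sets \<mu>. emeasure \<mu> A = (INF U\<in>{U. openQ p N U \<and> A \<subseteq> U}. emeasure \<mu> U)) \<and>
     (\<forall>A\<in>sets \<mu>. emeasure \<mu> A = (SUP K\<in>{K. compactQ p N K \<and> K \<subseteq> A}. emeasure \<mu> K))"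

definition fourier_measure_eqQ :: "nat \<Rightarrow> nat \<Rightarrow> ((nat \<Rightarrow> int \<Rightarrow> int) \<Rightarrow> real) \<Rightarrow> (nat \<Rightarrow> int \<Rightarrow> int) measure \<Rightarrow> bool" where
  "fourier_measure_eqQ p N f \<mu> \<longleftrightarrow> (\<forall>\<phi>. testfunQ p N \<phi> \<longrightarrow>
     integral\<^sup>L (haarQ p N) (\<lambda>x. complex_of_real (f x) * \<phi> x) = integral\<^sup>L \<mu> (fourierQ p N \<phi>))"

end

theory Submission
  imports Defs
begin

text \<open>Write B_k for the ball of radius p^(-k) around 0. The Fourier transform of the indicator of
  B_k is p^(-kN) times the indicator of B_(-k), so testing f = F mu against it gives
  mu(B_(-k)) = p^(kN) * (integral of f over B_k). With s = d * beta, the weight max(1,||xi||)^(-s) is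
  the sum over j >= 0 of (1 - p^(-s)) p^(-js) times the indicator of B_(-j). Integrating termwise and
  exchanging sum and integral again, the mu-integral becomes the integral of f against the finite
  geometric sum of (1 - p^(-s)) p^(j(N-s)) over 0 <= j <= m on the sphere ||x|| = p^(-m), which is the
  kernel on the right-hand side. So for N > 0 both integrals are equal; for N = 0 both are finite.\<close>

text \<open>The obstacle is the Fourier transform of a ball. The usual argument for orthogonality
  shifts the integration variable by an element on which the character is nontrivial. Here points
  are digit sequences and \<open>haarQ\<close> is a push-forward of Lebesgue measure, so additivity
  of \<open>chiQ\<close> and translation invariance would first have to be derived through carries.
  The digit map gives a way around: a one-dimensional ball around 0 pulls back to an interval [0,
  p^(-k)), the character becomes a step function on it, and the cancellation is a vanishing sum of
  p-th roots of unity. Only \<open>pairQ\<close> modulo 1 matters, and that depends on finitely many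
  digits. All series and integrals of the final comparison live in [0, infinity], where nonnegative
  terms may be exchanged with no prior finiteness; an identity there settles both directions of the
  equivalence at once.\<close>

section \<open>The additive character and the pairing modulo the integers\<close>

definition add_char :: "real \<Rightarrow> complex" where
  "add_char z = exp (- (2 * pi * \<i>) * complex_of_real z)"

lemma add_char_add: "add_char (z + w) = add_char z * add_char w"
  by (simp add: add_char_def distrib_left flip: exp_add)

lemma add_char_0 [simp]: "add_char 0 = 1"
  by (simp add: add_char_def)

lemma add_char_sum: "add_char (\<Sum>c\<in>A. g c) = (\<Prod>c\<in>A. add_char (g c))"
  by (induction A rule: infinite_finite_induct) (simp_all add: add_char_add)

lemma add_char_eq_1_iff: "add_char z = 1 \<longleftrightarrow> z \<in> \<int>"
proof
  assume "add_char z = 1"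
  then obtain n :: int where "- (2 * pi * z) = of_int (2 * n) * pi"
    unfolding add_char_def exp_eq_1 by auto
  then have "pi * z = pi * of_int (- n)" by simp
  then have "z = of_int (- n)" unfolding mult_cancel_left by simp
  then show "z \<in> \<int>" by (metis Ints_of_int)
next
  assume "z \<in> \<int>"
  then obtain n :: int where "z = of_int n" by (auto elim: Ints_cases)
  then have "- (2 * pi * z) = of_int (2 * (- n)) * pi" by simp
  then show "add_char z = 1"
    unfolding add_char_def exp_eq_1 by (auto intro!: exI[of _ "- n"])
qed

lemma add_char_eqI:
  assumes "z - w \<in> \<int>"
  shows "add_char z = add_char w"
  using assms add_char_add[of "z - w" w] by (simp add: add_char_eq_1_iff)

lemma add_char_mult_nat: "add_char (z * real n) = add_char z ^ n"
  by (induction n) (simp_all add: add_char_add distrib_left)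

lemma chiQ_eq_prod: "chiQ p N \<xi> x = (\<Prod>c<N. add_char (pairQ p (\<xi> c) (x c)))"
  unfolding chiQ_def add_char_sum[symmetric] by (simp add: add_char_def)

lemma powr_int_Ints:
  assumes "0 < p" "0 \<le> i"
  shows "real p powr real_of_int i \<in> \<int>"
proof -
  have "real p powr real_of_int i = real (p ^ nat i)"
    using assms by (metis of_nat_0_less_iff of_nat_power powr_real_of_int)
  then show ?thesis by (metis Ints_of_nat)
qed

lemma lowbQ_vanish:
  assumes "\<forall>i<l. a i = 0" "i < - int (lowbQ a)"
  shows "a i = 0"
proof -
  have "\<forall>i < - int (nat (- l)). a i = 0" using assms by auto
  then have "\<forall>i < - int (lowbQ a). a i = 0"
    unfolding lowbQ_def by (rule LeastI)
  then show ?thesis using assms by auto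
qed

text \<open>Terms with \<open>i + j >= 0\<close> are integers, so modulo 1 any finite
  \<open>R\<close> that contains all remaining possibly nonzero pairs gives the same value. This
  removes the truncation at \<open>lowbQ\<close>, which varies with the point, in favour of an index
  set that is uniform over a ball.\<close>

lemma pairQ_cong_Ints:
  assumes "0 < p" "\<forall>i<m. a i = 0" "\<forall>i<l. b i = 0" "finite R"
    and R: "\<And>i j. m \<le> i \<Longrightarrow> l \<le> j \<Longrightarrow> i + j < 0 \<Longrightarrow> (i, j) \<in> R"
  shows "pairQ p a b - (\<Sum>(i,j)\<in>R. real_of_int (a i * b j) * real p powr real_of_int (i + j)) \<in> \<int>"
proof -
  define T where "T = (\<lambda>(i,j). real_of_int (a i * b j) * real p powr real_of_int (i + j))"
  define K where "K = int (max (lowbQ a) (lowbQ b))"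
  define S where "S = {- int (lowbQ a)..<K} \<times> {- int (lowbQ b)..<K}"
  have "pairQ p a b = sum T S"
    using assms(1)
    by (simp add: pairQ_def Let_def truncQ_def K_def S_def T_def sum_product sum.cartesian_product powr_add mult_ac)
  moreover have "T ij \<in> \<int>" if "ij \<in> (S - R) \<union> (R - S)" for ij
  proof -
    obtain i j where ij: "ij = (i, j)" by force
    have "a i = 0 \<or> b j = 0 \<or> 0 \<le> i + j"
    proof (rule ccontr)
      assume *: "\<not> ?thesis"
      then have "m \<le> i" "l \<le> j" using assms(2,3) by (auto simp: not_less[symmetric])
      then have "ij \<in> R" using * R ij by auto
      then have "ij \<notin> S" using that by auto
      \<comment> \<open>These bounds and \<open>i + j < 0\<close> give
        \<open>i < - j <= lowbQ b <= K\<close>, and symmetrically \<open>j < K\<close>; hence the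
        pair lies in \<open>S\<close>.\<close>
      moreover have "- int (lowbQ a) \<le> i" "- int (lowbQ b) \<le> j"
        using * lowbQ_vanish[OF assms(2)] lowbQ_vanish[OF assms(3)] by (auto simp: not_less[symmetric])
      ultimately show False using * unfolding S_def K_def ij by auto
    qed
    then show ?thesis
      using powr_int_Ints[OF assms(1), of "i + j"] by (auto simp: T_def ij)
  qed
  moreover have "sum T S - sum T R = sum T (S - R) - sum T (R - S)"
  proof -
    have fS: "finite S" by (simp add: S_def)
    have "sum T S = sum T (S - R) + sum T (S \<inter> R)"
      using sum.Int_Diff[OF fS, of T R] by simp
    moreover have "sum T R = sum T (R - S) + sum T (S \<inter> R)"
      using sum.Int_Diff[OF assms(4), of T S] by (simp add: Int_commute)
    ultimately show ?thesis by simp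
  qed
  moreover have "sum T (S - R) - sum T (R - S) \<in> \<int>"
    using calculation(2) by (intro Ints_diff Ints_sum) auto
  ultimately show ?thesis unfolding T_def by simp
qed

lemma add_char_pairQ:
  assumes "0 < p" "\<forall>i<m. a i = 0" "\<forall>i<l. b i = 0" "finite R"
    and "\<And>i j. m \<le> i \<Longrightarrow> l \<le> j \<Longrightarrow> i + j < 0 \<Longrightarrow> (i, j) \<in> R"
  shows "add_char (pairQ p a b) = add_char (\<Sum>(i,j)\<in>R. real_of_int (a i * b j) * real p powr real_of_int (i + j))"
  by (rule add_char_eqI, rule pairQ_cong_Ints) (use assms in auto)

section \<open>Digits of a nonnegative real number\<close>

text \<open>By the rule for nested floors, all digits of index at most \<open>r\<close> can be read
  off the single integer floor(t p^(r+1)). This is what turns functions of these digits into step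
  functions of \<open>t\<close>.\<close>

lemma digitQ_eq_div:
  assumes "0 < p" "j \<le> r"
  shows "digitQ p t j = \<lfloor>t * real p powr real_of_int (r + 1)\<rfloor> div int p ^ nat (r - j) mod int p"
proof -
  have "real_of_int (int p ^ nat (r - j)) = real p powr real_of_int (r - j)"
    using assms by (simp add: powr_real_of_int flip: of_int_diff)
  moreover have "real p powr real_of_int (r + 1) = real p powr real_of_int (j + 1) * real p powr real_of_int (r - j)"
    by (simp add: algebra_simps flip: powr_add)
  ultimately have "t * real p powr real_of_int (j + 1) = t * real p powr real_of_int (r + 1) / real_of_int (int p ^ nat (r - j))"
    using assms by simp
  then show ?thesis
    unfolding digitQ_def by (simp only: floor_divide_real_eq_div zero_le_power of_nat_0_le_iff)
qed

lemma digitQ_eq_0: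
  assumes "1 < p" "0 \<le> t" "t < real p powr - real_of_int k" "i < k"
  shows "digitQ p t i = 0"
proof -
  have "t * real p powr real_of_int (i + 1) \<le> t * real p powr real_of_int k"
    using assms by (intro mult_left_mono powr_mono) auto
  also have "\<dots> < real p powr - real_of_int k * real p powr real_of_int k"
    using assms by (intro mult_strict_right_mono) auto
  also have "\<dots> = 1" using assms by (simp flip: powr_add)
  finally have "\<lfloor>t * real p powr real_of_int (i + 1)\<rfloor> = 0"
    using assms by (simp add: floor_eq_iff)
  then show ?thesis by (simp add: digitQ_def)
qed

lemma ex_powr_greater:
  assumes "1 < p"
  obtains k :: int where "t < real p powr - real_of_int k"
proof -
  obtain n where "t < real p ^ n" using real_arch_pow[of "real p" t] assms by auto
  then have "t < real p powr - real_of_int (- int n)" using assms by (simp add: powr_realpow)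
  then show ?thesis by (rule that)
qed

text \<open>A vanishing digit only says that a floor is divisible by \<open>p\<close>. The induction
  therefore starts at some \<open>k0\<close> with t p^k0 < 1 and moves up: t p^i < 1 bounds t
  p^(i+1) by \<open>p\<close>, so there the digit is the whole floor. The result identifies the
  preimage of a ball with an interval.\<close>

lemma digitQ_vanish_iff:
  assumes "1 < p" "0 \<le> t"
  shows "(\<forall>i<k. digitQ p t i = 0) \<longleftrightarrow> t < real p powr - real_of_int k"
proof
  assume z: "\<forall>i<k. digitQ p t i = 0"
  obtain k0 where k0: "t < real p powr - real_of_int k0" using ex_powr_greater[OF assms(1)] .
  show "t < real p powr - real_of_int k"
  proof (cases "k \<le> k0")
    case True
    then have "real p powr - real_of_int k0 \<le> real p powr - real_of_int k"
      using assms by (intro powr_mono) auto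
    then show ?thesis using k0 by simp
  next
    case False
    have "i \<le> k \<longrightarrow> t * real p powr real_of_int i < 1" if "k0 \<le> i" for i
      using that
    proof (induction i rule: int_ge_induct)
      case base
      have "t * real p powr real_of_int k0 < real p powr - real_of_int k0 * real p powr real_of_int k0"
        using assms k0 by (intro mult_strict_right_mono) auto
      then show ?case using assms by (simp flip: powr_add)
    next
      case (step i)
      show ?case
      proof
        assume i: "i + 1 \<le> k"
        let ?u = "t * real p powr real_of_int (i + 1)"
        have "?u = t * real p powr real_of_int i * real p" using assms by (simp add: powr_add)
        moreover have "t * real p powr real_of_int i < 1" using step i by simp
        ultimately have "?u < real p" using assms by (simp only: mult_less_cancel_right_disj) simp
        then have "\<lfloor>?u\<rfloor> < int p" "0 \<le> \<lfloor>?u\<rfloor>" using assms by (auto simp: floor_less_iff)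
        then have "digitQ p t i = \<lfloor>?u\<rfloor>" by (simp add: digitQ_def)
        then have "\<lfloor>?u\<rfloor> = 0" using z i by auto
        then show "?u < 1" by (simp add: floor_eq_iff)
      qed
    qed
    from this[of k] False have "t * real p powr real_of_int k < 1" by simp
    then show ?thesis using assms by (simp add: powr_minus field_simps)
  qed
qed (use assms digitQ_eq_0 in blast)

lemma digitQ_in_Qp:
  assumes "1 < p" "0 \<le> t"
  shows "digitQ p t \<in> Qp p"
proof -
  obtain k where "t < real p powr - real_of_int k" using ex_powr_greater[OF assms(1)] .
  then have "\<forall>i<k. digitQ p t i = 0" using assms digitQ_vanish_iff by blast
  moreover have "0 \<le> digitQ p t i \<and> digitQ p t i < int p" for i
    using assms by (auto simp: digitQ_def)
  ultimately show ?thesis unfolding Qp_def by blast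
qed

section \<open>Orthogonality of characters in one dimension\<close>

lemma has_bochner_integral_nat_floor:
  fixes F :: "nat \<Rightarrow> complex"
  shows "has_bochner_integral lborel (\<lambda>u. indicator {0..<real n} u * F (nat \<lfloor>u\<rfloor>)) (\<Sum>q<n. F q)"
proof -
  have "indicator {0..<real n} u * F (nat \<lfloor>u\<rfloor>) = (\<Sum>q<n. indicator {real q..<real q + 1} u *\<^sub>R F q)" for u
  proof -
    have "(\<Sum>q<n. indicator {real q..<real q + 1} u *\<^sub>R F q)
        = (\<Sum>q<n. if q = nat \<lfloor>u\<rfloor> then indicator {0..<real n} u * F q else 0)"
    proof (rule sum.cong)
      fix q assume q: "q \<in> {..<n}"
      then have "real q + 1 \<le> real n" by auto
      show "indicator {real q..<real q + 1} u *\<^sub>R F q = (if q = nat \<lfloor>u\<rfloor> then indicator {0..<real n} u * F q else 0)"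
      \<comment> \<open>The condition \<open>0 \<le> u\<close> is separate because
        \<open>nat\<close> sends the negative floors to 0, which would match
        \<open>q = 0\<close>.\<close>
      proof (cases "0 \<le> u \<and> q = nat \<lfloor>u\<rfloor>")
        case True
        then have "real q \<le> u" "u < real q + 1" by linarith+
        then have "u \<in> {real q..<real q + 1}" "u \<in> {0..<real n}"
          using \<open>real q + 1 \<le> real n\<close> by auto
        then show ?thesis using True by simp
      next
        case False
        then have "u < 0 \<or> q \<noteq> nat \<lfloor>u\<rfloor> \<and> (u < real q \<or> real q + 1 \<le> u)" by linarith
        then show ?thesis by (auto simp: indicator_def)
      qed
    qed simp
    also have "\<dots> = indicator {0..<real n} u * F (nat \<lfloor>u\<rfloor>)"
    proof (cases "u \<in> {0..<real n}")
      case True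
      then have "nat \<lfloor>u\<rfloor> < n" by (auto simp: nat_less_iff floor_less_iff)
      then show ?thesis by simp
    qed simp
    finally show ?thesis by simp
  qed
  moreover have "has_bochner_integral lborel (\<lambda>u. \<Sum>q<n. indicator {real q..<real q + 1} u *\<^sub>R F q) (\<Sum>q<n. F q)"
  proof (rule has_bochner_integral_sum)
    fix q
    have "has_bochner_integral lborel (\<lambda>u. indicator {real q..<real q + 1} u *\<^sub>R F q) (measure lborel {real q..<real q + 1} *\<^sub>R F q)"
      by (intro has_bochner_integral_scaleR_left has_bochner_integral_real_indicator) auto
    then show "has_bochner_integral lborel (\<lambda>u. indicator {real q..<real q + 1} u *\<^sub>R F q) (F q)" by simp
  qed
  ultimately show ?thesis by simp
qed

text \<open>Grouping by \<open>q div p\<close> leaves the full sum of the powers of a nontrivial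
  p-th root of unity, a geometric sum with numerator 0, as a factor of each group.\<close>

lemma sum_character_digit:
  fixes g :: "nat \<Rightarrow> 'a::field"
  assumes "\<omega> \<noteq> 1" "\<omega> ^ p = 1" "0 < p"
  shows "(\<Sum>q<Q * p. \<omega> ^ (q mod p) * g (q div p)) = 0"
proof -
  have "(\<Sum>q<Q * p. \<omega> ^ (q mod p) * g (q div p)) = (\<Sum>m<Q. \<Sum>q\<in>{m * p..<m * p + p}. \<omega> ^ (q mod p) * g (q div p))"
    by (rule sum.nat_group[symmetric])
  also have "\<dots> = (\<Sum>m<Q. \<Sum>d<p. \<omega> ^ d * g m)"
  proof (rule sum.cong)
    fix m
    show "(\<Sum>q\<in>{m * p..<m * p + p}. \<omega> ^ (q mod p) * g (q div p)) = (\<Sum>d<p. \<omega> ^ d * g m)"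
      by (rule sum.reindex_bij_witness[of _ "\<lambda>d. m * p + d" "\<lambda>q. q - m * p"])
        (auto simp: le_iff_add)
  qed simp
  also have "\<dots> = 0"
    using assms by (simp add: geometric_sum flip: sum_distrib_right)
  finally show ?thesis .
qed

lemma lowest_nonzero_digit:
  assumes "a \<in> Qp p" "a i \<noteq> 0"
  obtains m where "m \<le> i" "a m \<noteq> 0" "\<forall>j<m. a j = 0"
proof -
  obtain n where n: "\<forall>j<n. a j = 0" using assms by (auto simp: Qp_def)
  then have "n \<le> i" using assms(2) by (meson not_le)
  then have ex: "a (n + int (nat (i - n))) \<noteq> 0" using assms(2) by simp
  define d where "d = (LEAST d. a (n + int d) \<noteq> 0)"
  have "a (n + int d) \<noteq> 0" unfolding d_def using ex by (rule LeastI)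
  moreover have "a j = 0" if "j < n + int d" for j
  proof (cases "j < n")
    case False
    then have "nat (j - n) < d" using that by simp
    then have "a (n + int (nat (j - n))) = 0" unfolding d_def by (blast dest: not_less_Least)
    then show ?thesis using False by simp
  qed (use n in blast)
  moreover have "n + int d \<le> i" using calculation(2) assms(2) by (meson not_le)
  ultimately show ?thesis using that by blast
qed

text \<open>The ball of radius p^(-k) consists of the sequences without digits below
  \<open>k\<close>. Pairing with \<open>a\<close> is trivial on it when \<open>a\<close> has no
  digits below \<open>- k\<close>; otherwise the character oscillates and its integral
  cancels.\<close>

lemma has_bochner_integral_digit_char:
  assumes p: "1 < p" and a: "a \<in> Qp p"
  shows "has_bochner_integral (restrict_space lborel {0..})
    (\<lambda>t. if \<forall>i<k. digitQ p t i = 0 then add_char (pairQ p a (digitQ p t)) else 0)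
    (if \<forall>i < - k. a i = 0 then of_real (real p powr - real_of_int k) else 0)"
    (is "has_bochner_integral _ ?h _")
proof (cases "\<forall>i < - k. a i = 0")
  case True
  have "indicator {0..} t *\<^sub>R ?h t = indicator {0..<real p powr - real_of_int k} t *\<^sub>R 1" for t
  proof (cases "0 \<le> t \<and> t < real p powr - real_of_int k")
    case T: True
    then have v: "\<forall>i<k. digitQ p t i = 0" using p digitQ_vanish_iff by blast
    \<comment> \<open>No pair with \<open>i >= - k\<close> and \<open>j >= k\<close> has
      \<open>i + j < 0\<close>, so the empty \<open>R\<close> is admissible and the pairing is an
      integer.\<close>
    have "add_char (pairQ p a (digitQ p t)) = 1"
      using add_char_pairQ[OF _ True v, of p "{}"] p by auto
    then show ?thesis using T v by simp
  qed (use p digitQ_vanish_iff[of p t k] in \<open>auto simp: indicator_def\<close>)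
  moreover have "has_bochner_integral lborel (\<lambda>t. indicator {0..<real p powr - real_of_int k} t *\<^sub>R (1::complex))
      (measure lborel {0..<real p powr - real_of_int k} *\<^sub>R 1)"
    by (intro has_bochner_integral_scaleR_left has_bochner_integral_real_indicator) auto
  ultimately show ?thesis
    using True by (simp add: has_bochner_integral_restrict_space scaleR_conv_of_real)
next
  case False
  then obtain i0 where "i0 < -k" "a i0 \<noteq> 0" by auto
  then obtain m where m: "m < -k" "a m \<noteq> 0" "\<forall>j<m. a j = 0"
    using lowest_nonzero_digit[OF a] by (metis order.strict_trans1)
  txt \<open>The integrand depends only on the integer part of t * p^(r+1). In the pairing, the digit of t with
    index r meets only the lowest digit a m, so summing over it gives a full sum of p-th roots of unity.\<close>
  define r where "r = - m - 1"
  have rk: "k \<le> r" using m by (simp add: r_def)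
  \<comment> \<open>From \<open>m <= i\<close>, \<open>k <= j\<close> and \<open>i + j < 0\<close>
    follow \<open>i < - k\<close> and \<open>j <= r\<close>, with \<open>i = m\<close> if
    \<open>j = r\<close>. So \<open>insert (m, r) T\<close> covers every pair that matters, and the
    pair \<open>(m, r)\<close> contributes \<open>a m / p\<close> times the digit of index
    \<open>r\<close>.\<close>
  define T where "T = {(i,j) \<in> {m..< - k} \<times> {k..<r}. i + j < 0}"
  have fT: "finite T" unfolding T_def by (rule finite_subset[of _ "{m..< - k} \<times> {k..<r}"]) auto
  define c where "c = real p powr real_of_int (r + 1)"
  have c: "0 < c" using p by (simp add: c_def)
  \<comment> \<open>The interval [0, p^(-k)), stretched by \<open>c\<close>, consists of p^(r+1-k)
    unit intervals. One factor \<open>p\<close> is split off for the last base-p digit of the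
    integer part, which is the digit of index \<open>r\<close>.\<close>
  have len: "real (p ^ nat (r - k) * p) = real p powr - real_of_int k * c"
  proof -
    have "real (p ^ nat (r - k)) = real p powr real_of_int (r - k)"
      using p rk by (simp add: powr_real_of_int flip: of_int_diff)
    moreover have "real p powr real_of_int (r - k) * real p = real p powr (real_of_int (r - k) + 1)"
      using p by (simp add: powr_add)
    moreover have "real_of_int (r - k) + 1 = - real_of_int k + real_of_int (r + 1)" by simp
    ultimately show ?thesis by (simp add: c_def powr_add[symmetric] del: of_int_diff of_int_add)
  qed
  define \<omega> where "\<omega> = add_char (real_of_int (a m) / real p)"
  \<comment> \<open>The argument of \<open>g\<close> will be \<open>q div p\<close>: dropping the
    last digit shifts the rest, hence the exponent \<open>r - 1 - j\<close> in place of
    \<open>r - j\<close>.\<close>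
  define g where "g q = add_char (\<Sum>(i,j)\<in>T. real_of_int (a i * int (q div p ^ nat (r - 1 - j) mod p)) * real p powr real_of_int (i + j))" for q :: nat
  have "\<omega> \<noteq> 1"
  proof
    assume "\<omega> = 1"
    then obtain z where "real_of_int (a m) / real p = real_of_int z"
      unfolding \<omega>_def add_char_eq_1_iff by (auto elim: Ints_cases)
    then have "real_of_int (a m) = real_of_int (z * int p)" using p by (simp add: field_simps)
    then have "a m = z * int p" by linarith
    moreover have "0 \<le> a m" "a m < int p" using a by (auto simp: Qp_def)
    ultimately show False using m(2)
      by (metis mod_mult_self2_is_0 mod_pos_pos_trivial)
  qed
  moreover have "\<omega> ^ p = 1"
    unfolding \<omega>_def add_char_mult_nat[symmetric] using p by (simp add: add_char_eq_1_iff)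
  ultimately have "(\<Sum>q<p ^ nat (r - k) * p. \<omega> ^ (q mod p) * g (q div p)) = 0"
    using p by (intro sum_character_digit) auto
  then have "has_bochner_integral lborel (\<lambda>u. indicator {0..<real (p ^ nat (r - k) * p)} u
        * (\<omega> ^ (nat \<lfloor>u\<rfloor> mod p) * g (nat \<lfloor>u\<rfloor> div p))) 0"
    using has_bochner_integral_nat_floor[of "p ^ nat (r - k) * p" "\<lambda>q. \<omega> ^ (q mod p) * g (q div p)"] by simp
  then have "has_bochner_integral lborel (\<lambda>t. indicator {0..<real (p ^ nat (r - k) * p)} (0 + c * t)
        * (\<omega> ^ (nat \<lfloor>0 + c * t\<rfloor> mod p) * g (nat \<lfloor>0 + c * t\<rfloor> div p))) (0 /\<^sub>R \<bar>c\<bar>)"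
    using c by (subst (asm) lborel_has_bochner_integral_real_affine_iff[of c _ _ 0]) auto
  moreover have "indicator {0..<real (p ^ nat (r - k) * p)} (0 + c * t)
        * (\<omega> ^ (nat \<lfloor>0 + c * t\<rfloor> mod p) * g (nat \<lfloor>0 + c * t\<rfloor> div p)) = indicator {0..} t *\<^sub>R ?h t" for t
  proof (cases "0 \<le> t \<and> t < real p powr - real_of_int k")
    case t: True
    then have v: "\<forall>i<k. digitQ p t i = 0" using p digitQ_vanish_iff by blast
    have ct: "c * t < real (p ^ nat (r - k) * p)"
      unfolding len using t c by simp
    define q where "q = nat \<lfloor>c * t\<rfloor>"
    have dig: "digitQ p t j = int (q div p ^ nat (r - j) mod p)" if "j \<le> r" for j
      using digitQ_eq_div[of p j r t] that p t c
      by (simp add: q_def c_def mult.commute zdiv_int zmod_int)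
    have dig_r: "digitQ p t r = int (q mod p)" using dig[of r] by simp
    have dig_less: "digitQ p t j = int (q div p div p ^ nat (r - 1 - j) mod p)" if "j < r" for j
    proof -
      have "nat (r - j) = Suc (nat (r - 1 - j))" using that by simp
      then show ?thesis using dig[of j] that by (simp add: div_mult2_eq)
    qed
    have "add_char (pairQ p a (digitQ p t))
        = add_char (\<Sum>(i,j)\<in>insert (m, r) T. real_of_int (a i * digitQ p t j) * real p powr real_of_int (i + j))"
    proof (rule add_char_pairQ[OF _ m(3) v])
      fix i j assume "m \<le> i" "k \<le> j" "i + j < 0"
      then show "(i, j) \<in> insert (m, r) T" by (auto simp: T_def r_def)
    qed (use p fT in auto)
    also have "(m, r) \<notin> T" by (simp add: T_def)
    then have "(\<Sum>(i,j)\<in>insert (m, r) T. real_of_int (a i * digitQ p t j) * real p powr real_of_int (i + j))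
        = real_of_int (a m) / real p * real (q mod p)
          + (\<Sum>(i,j)\<in>T. real_of_int (a i * digitQ p t j) * real p powr real_of_int (i + j))"
      using p by (simp add: fT dig_r[unfolded r_def] r_def powr_minus field_simps)
    also have "(\<Sum>(i,j)\<in>T. real_of_int (a i * digitQ p t j) * real p powr real_of_int (i + j))
        = (\<Sum>(i,j)\<in>T. real_of_int (a i * int (q div p div p ^ nat (r - 1 - j) mod p)) * real p powr real_of_int (i + j))"
      by (rule sum.cong) (auto simp: T_def dig_less)
    finally have "add_char (pairQ p a (digitQ p t)) = \<omega> ^ (q mod p) * g (q div p)"
      by (simp only: add_char_add add_char_mult_nat \<omega>_def g_def)
    then show ?thesis using v t ct c by (simp add: q_def)
  next
    case t: False
    have "0 + c * t \<notin> {0..<real (p ^ nat (r - k) * p)}"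
      unfolding len using t c by (auto simp: zero_le_mult_iff)
    then show ?thesis using t p digitQ_vanish_iff[of p t k] by (auto simp: indicator_def)
  qed
  ultimately show ?thesis
    by (simp add: has_bochner_integral_restrict_space if_not_P[OF False])
qed

section \<open>Norm, balls and compactness\<close>

lemma absQ_le_iff:
  assumes "1 < p" "a \<in> Qp p"
  shows "absQ p a \<le> real p powr - real_of_int k \<longleftrightarrow> (\<forall>i<k. a i = 0)"
proof (cases "\<forall>i. a i = 0")
  case False
  then obtain i where "a i \<noteq> 0" by auto
  then obtain m where m: "a m \<noteq> 0" "\<forall>j<m. a j = 0"
    using lowest_nonzero_digit[OF assms(2)] by metis
  have "ordQ a = m"
    unfolding ordQ_def
  proof (rule the_equality)
    fix i assume "a i \<noteq> 0 \<and> (\<forall>j<i. a j = 0)"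
    then show "i = m" using m by (meson linorder_neqE)
  qed (use m in blast)
  then have "absQ p a \<le> real p powr - real_of_int k \<longleftrightarrow> k \<le> m"
    using assms by (simp only: absQ_def if_not_P[OF False]) simp
  also have "\<dots> \<longleftrightarrow> (\<forall>i<k. a i = 0)" using m by (auto simp: not_less[symmetric])
  finally show ?thesis .
qed (simp add: absQ_def)

lemma absQ_cases:
  "absQ p a = 0 \<or> (\<exists>m. absQ p a = real p powr - real_of_int m)"
  by (auto simp: absQ_def)

lemma normQ_le_iff:
  assumes "1 < p" "x \<in> QpN p N"
  shows "normQ p N x \<le> real p powr - real_of_int k \<longleftrightarrow> x \<in> ballQ p N zeroQ k"
proof -
  have "normQ p N x \<le> real p powr - real_of_int k \<longleftrightarrow> (\<forall>c<N. absQ p (x c) \<le> real p powr - real_of_int k)"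
    unfolding normQ_def by (subst Max_le_iff) auto
  also have "\<dots> \<longleftrightarrow> (\<forall>c<N. \<forall>i<k. x c i = 0)"
    using assms absQ_le_iff by (simp add: QpN_def)
  also have "\<dots> \<longleftrightarrow> x \<in> ballQ p N zeroQ k"
    using assms by (simp add: ballQ_def zeroQ_def)
  finally show ?thesis .
qed

lemma normQ_cases:
  assumes "1 < p" "x \<in> QpN p N" "x \<noteq> zeroQ"
  obtains m where "normQ p N x = real p powr - real_of_int m"
proof -
  have "normQ p N x \<in> insert 0 {absQ p (x c) | c. c < N}"
    unfolding normQ_def by (rule Max_in) auto
  then consider "normQ p N x = 0" | m where "normQ p N x = real p powr - real_of_int m"
  proof (cases "normQ p N x = 0")
    case False
    then obtain c where "normQ p N x = absQ p (x c)"
      using \<open>normQ p N x \<in> _\<close> by auto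
    then show thesis using absQ_cases[of p "x c"] False that(2) by auto
  qed
  then show ?thesis
  proof cases
    case 1
    then have "x \<in> ballQ p N zeroQ k" for k
      using normQ_le_iff[OF assms(1,2), of k] by simp
    then have "\<forall>k. \<forall>c<N. \<forall>i<k. x c i = 0" by (simp add: ballQ_def zeroQ_def)
    then have "\<forall>c<N. \<forall>i. x c i = 0" by (meson less_add_one)
    then have "x c i = 0" for c i using assms(2) by (cases "c < N") (auto simp: QpN_def)
    then have "x = zeroQ" by (simp add: zeroQ_def fun_eq_iff)
    then show ?thesis using assms by simp
  qed (rule that)
qed

lemma ballQ_eq: "y \<in> ballQ p N x k \<Longrightarrow> ballQ p N y k = ballQ p N x k"
  by (auto simp: ballQ_def)

lemma ballQ_mono: "k \<le> l \<Longrightarrow> ballQ p N x l \<subseteq> ballQ p N x k"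
  by (auto simp: ballQ_def)

lemma ballQ_subset: "ballQ p N x k \<subseteq> QpN p N"
  by (auto simp: ballQ_def)

lemma centre_in_ballQ: "x \<in> QpN p N \<Longrightarrow> x \<in> ballQ p N x k"
  by (simp add: ballQ_def)

lemma zeroQ_in_QpN: "1 < p \<Longrightarrow> zeroQ \<in> QpN p N"
  by (auto simp: QpN_def zeroQ_def Qp_def)

lemma openQ_ballQ: "openQ p N (ballQ p N x k)"
  unfolding openQ_def using ballQ_eq ballQ_subset by blast

text \<open>A subball of the next smaller radius is determined by the \<open>N\<close> digits of
  index \<open>k\<close>, each of which takes at most \<open>p\<close> values.\<close>

lemma finite_subballs: "finite {ballQ p N y (k + 1) | y. y \<in> ballQ p N x k}"
proof -
  let ?F = "{..<N} \<rightarrow>\<^sub>E {0..<int p}"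
  have "{ballQ p N y (k + 1) | y. y \<in> ballQ p N x k}
      \<subseteq> (\<lambda>g. {y \<in> ballQ p N x k. \<forall>c<N. y c k = g c}) ` ?F"
  proof (clarify)
    fix y assume y: "y \<in> ballQ p N x k"
    have "ballQ p N y (k + 1) = {z \<in> ballQ p N x k. \<forall>c<N. z c k = restrict (\<lambda>c. y c k) {..<N} c}"
    proof (intro equalityI subsetI)
      fix z assume "z \<in> ballQ p N y (k + 1)"
      then show "z \<in> {z \<in> ballQ p N x k. \<forall>c<N. z c k = restrict (\<lambda>c. y c k) {..<N} c}"
        using y by (auto simp: ballQ_def)
    next
      fix z assume z: "z \<in> {z \<in> ballQ p N x k. \<forall>c<N. z c k = restrict (\<lambda>c. y c k) {..<N} c}"
      have "z c i = y c i" if "c < N" "i < k + 1" for c i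
        using y z that by (cases "i = k") (auto simp: ballQ_def)
      then show "z \<in> ballQ p N y (k + 1)" using z by (simp add: ballQ_def)
    qed
    moreover have "restrict (\<lambda>c. y c k) {..<N} \<in> ?F"
      using y by (auto simp: ballQ_def QpN_def Qp_def)
    ultimately show "ballQ p N y (k + 1) \<in> (\<lambda>g. {y \<in> ballQ p N x k. \<forall>c<N. y c k = g c}) ` ?F"
      by blast
  qed
  then show ?thesis by (rule finite_subset) (auto intro!: finite_PiE)
qed

text \<open>A Koenig argument: a ball without finite subcover contains a next smaller ball without
  one. The nested bad balls fix more and more digits and so define a limit point; the member of the
  cover around that point swallows a bad ball.\<close>

lemma compactQ_ballQ:
  assumes x: "x \<in> QpN p N"
  shows "compactQ p N (ballQ p N x k)"
  unfolding compactQ_def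
proof (intro conjI allI impI ballQ_subset)
  fix \<U> assume U: "(\<forall>U\<in>\<U>. openQ p N U) \<and> ballQ p N x k \<subseteq> \<Union>\<U>"
  define bad where "bad B \<longleftrightarrow> \<not> (\<exists>\<V>\<subseteq>\<U>. finite \<V> \<and> B \<subseteq> \<Union>\<V>)" for B
  show "\<exists>\<V>\<subseteq>\<U>. finite \<V> \<and> ballQ p N x k \<subseteq> \<Union>\<V>"
  proof (rule ccontr)
    assume "\<not> ?thesis"
    then have bad0: "bad (ballQ p N x k)" by (simp add: bad_def)
    have step: "\<exists>z. z \<in> ballQ p N y l \<and> bad (ballQ p N z (l + 1))" if "bad (ballQ p N y l)" for y l
    proof (rule ccontr)
      assume "\<not> ?thesis"
      then have "\<forall>B\<in>{ballQ p N z (l + 1) | z. z \<in> ballQ p N y l}. \<exists>\<V>\<subseteq>\<U>. finite \<V> \<and> B \<subseteq> \<Union>\<V>"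
      proof (intro ballI)
        fix B assume "B \<in> {ballQ p N z (l + 1) | z. z \<in> ballQ p N y l}"
        then have "\<not> bad B" using \<open>\<nexists>z. z \<in> ballQ p N y l \<and> bad (ballQ p N z (l + 1))\<close> by blast
        then show "\<exists>\<V>\<subseteq>\<U>. finite \<V> \<and> B \<subseteq> \<Union>\<V>" unfolding bad_def by blast
      qed
      from bchoice[OF this] obtain V where
        V: "\<And>B. B \<in> {ballQ p N z (l + 1) | z. z \<in> ballQ p N y l} \<Longrightarrow> V B \<subseteq> \<U> \<and> finite (V B) \<and> B \<subseteq> \<Union>(V B)"
        by blast
      let ?W = "\<Union>(V ` {ballQ p N z (l + 1) | z. z \<in> ballQ p N y l})"
      have "finite ?W" using V finite_subballs by (intro finite_UN_I) auto
      moreover have "?W \<subseteq> \<U>" using V by blast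
      moreover have "ballQ p N y l \<subseteq> \<Union>?W"
      proof
        fix z assume z: "z \<in> ballQ p N y l"
        then have "z \<in> ballQ p N z (l + 1)" using ballQ_subset centre_in_ballQ by blast
        then show "z \<in> \<Union>?W" using V[of "ballQ p N z (l + 1)"] z by blast
      qed
      ultimately show False using that unfolding bad_def by blast
    qed
    have "\<exists>s. \<forall>n. (s n \<in> ballQ p N x k \<and> bad (ballQ p N (s n) (k + int n))) \<and> s (Suc n) \<in> ballQ p N (s n) (k + int n)"
    proof (rule dependent_nat_choice)
      show "\<exists>z. z \<in> ballQ p N x k \<and> bad (ballQ p N z (k + int 0))"
        using bad0 centre_in_ballQ[OF x] by auto
      fix y n assume y: "y \<in> ballQ p N x k \<and> bad (ballQ p N y (k + int n))"
      obtain z where "z \<in> ballQ p N y (k + int n)" "bad (ballQ p N z (k + int n + 1))"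
        using step y by blast
      moreover have "k + int n + 1 = k + int (Suc n)" by simp
      moreover have "z \<in> ballQ p N x k"
        using calculation(1) y ballQ_mono[of k "k + int n"] ballQ_eq by fastforce
      ultimately show "\<exists>z. (z \<in> ballQ p N x k \<and> bad (ballQ p N z (k + int (Suc n)))) \<and> z \<in> ballQ p N y (k + int n)"
        by metis
    qed
    then obtain s where s0: "\<And>n. s n \<in> ballQ p N x k" and s2: "\<And>n. bad (ballQ p N (s n) (k + int n))"
        and s3: "\<And>n. s (Suc n) \<in> ballQ p N (s n) (k + int n)"
      by blast
    have s1: "s n \<in> QpN p N" for n using s0 ballQ_subset by blast
    have s_le: "s (n + d) \<in> ballQ p N (s n) (k + int n)" for n d
    proof (induction d)
      case (Suc d)
      have "s (n + Suc d) \<in> ballQ p N (s (n + d)) (k + int n)"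
        using s3[of "n + d"] ballQ_mono[of "k + int n" "k + int (n + d)"] by auto
      then show ?case using ballQ_eq[OF Suc] by blast
    qed (use s1 centre_in_ballQ in simp)
    \<comment> \<open>The ball around \<open>s n\<close> fixes the digits of index below
      \<open>k + n\<close>, so \<open>nat (i - k + 1)\<close> is the first stage at which digit
      \<open>i\<close> is final.\<close>
    define y where "y c i = s (nat (i - k + 1)) c i" for c i
    have y_eq: "y c i = s n c i" if "c < N" "i < k + int n" for c i n
    proof -
      have "nat (i - k + 1) \<le> n" using that by simp
      then obtain d where d: "n = nat (i - k + 1) + d" using le_Suc_ex by blast
      have "i < k + int (nat (i - k + 1))" by simp
      then show ?thesis using s_le[of "nat (i - k + 1)" d] that d by (simp add: ballQ_def y_def)
    qed
    have "y c \<in> Qp p" if "c < N" for c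
    proof -
      have "s 0 c \<in> Qp p" using s1[of 0] that by (simp add: QpN_def)
      then obtain n0 where n0: "\<forall>i<n0. s 0 c i = 0" by (auto simp: Qp_def)
      \<comment> \<open>Only below \<open>k\<close> are the digits of the limit those of
        \<open>s 0\<close>, hence the minimum.\<close>
      then have "\<forall>i<min n0 k. y c i = 0" using y_eq[OF that, of _ 0] by simp
      moreover have "0 \<le> y c i \<and> y c i < int p" for i
        using s1[of "nat (i - k + 1)"] that by (simp add: QpN_def Qp_def y_def)
      ultimately show ?thesis unfolding Qp_def by blast
    qed
    moreover have "y c = (\<lambda>_. 0)" if "N \<le> c" for c
      using s1 that by (auto simp: y_def QpN_def fun_eq_iff)
    ultimately have yQ: "y \<in> QpN p N" by (auto simp: QpN_def)
    then have y_ball: "y \<in> ballQ p N (s n) (k + int n)" for n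
      using y_eq by (simp add: ballQ_def)
    have "y \<in> ballQ p N x k" using y_ball[of 0] ballQ_eq[OF s0[of 0]] by auto
    then obtain A where A: "A \<in> \<U>" "y \<in> A" using U by blast
    then have "openQ p N A" using U by blast
    then obtain l where l: "ballQ p N y l \<subseteq> A" using A(2) unfolding openQ_def by blast
    define n where "n = nat (l - k)"
    have "ballQ p N (s n) (k + int n) = ballQ p N y (k + int n)"
      using ballQ_eq[OF y_ball] by simp
    also have "\<dots> \<subseteq> ballQ p N y l" by (rule ballQ_mono) (simp add: n_def)
    finally have "ballQ p N (s n) (k + int n) \<subseteq> \<Union>{A}" using l by simp
    then have "\<not> bad (ballQ p N (s n) (k + int n))"
      unfolding bad_def not_not using A(1) by (intro exI[of _ "{A}"]) simp
    then show False using s2 by blast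
  qed
qed

section \<open>Borel sets and measurability\<close>

lemma space_borelQ [simp]: "space (borelQ p N) = QpN p N"
  by (simp add: borelQ_def space_measure_of_conv)

lemma space_haarQ [simp]: "space (haarQ p N) = QpN p N"
  by (simp add: haarQ_def)

lemma sets_haarQ [simp, measurable_cong]: "sets (haarQ p N) = sets (borelQ p N)"
  by (simp add: haarQ_def)

lemma ballQ_in_sets: "x \<in> QpN p N \<Longrightarrow> ballQ p N x k \<in> sets (borelQ p N)"
proof -
  assume "x \<in> QpN p N"
  moreover have "{ballQ p N x k |x k. x \<in> QpN p N} \<subseteq> Pow (QpN p N)" by (auto simp: ballQ_def)
  ultimately show ?thesis
    unfolding borelQ_def by (subst sets_measure_of) (auto intro!: sigma_sets.Basic)
qed

lemma compactQ_cover: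
  assumes "compactQ p N K" "K \<subseteq> \<Union>\<U>" "\<And>U. U \<in> \<U> \<Longrightarrow> openQ p N U"
  obtains \<V> where "\<V> \<subseteq> \<U>" "finite \<V>" "K \<subseteq> \<Union>\<V>"
proof -
  have "(\<forall>U\<in>\<U>. openQ p N U) \<and> K \<subseteq> \<Union>\<U>" using assms by simp
  then have "\<exists>\<V>\<subseteq>\<U>. finite \<V> \<and> K \<subseteq> \<Union>\<V>"
    using assms(1) unfolding compactQ_def by (elim conjE allE[of _ "\<U>"]) simp
  then show ?thesis by (elim exE conjE) (rule that)
qed

text \<open>By compactness finitely many subballs of constancy cover the supporting ball, so the
  part of a preimage inside it is a finite union of balls. The complement is added when 0 lies in
  the target set.\<close>

lemma borel_measurable_locally_constant:
  fixes \<phi> :: "_ \<Rightarrow> 'b::{zero, topological_space}"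
  assumes x: "x \<in> QpN p N"
    and const: "\<And>y z. y \<in> ballQ p N x k \<Longrightarrow> z \<in> ballQ p N y n \<Longrightarrow> \<phi> z = \<phi> y"
    and supp: "\<And>y. y \<in> QpN p N - ballQ p N x k \<Longrightarrow> \<phi> y = 0"
  shows "\<phi> \<in> borel_measurable (borelQ p N)"
proof (rule measurableI)
  fix A :: "'b set"
  let ?B = "ballQ p N x k"
  let ?U = "(\<lambda>y. ballQ p N y n) ` ?B"
  have cov: "?B \<subseteq> \<Union>?U"
  proof
    fix y assume y: "y \<in> ?B"
    then have "y \<in> ballQ p N y n" by (simp add: ballQ_def)
    then show "y \<in> \<Union>?U" using y by blast
  qed
  have op: "openQ p N U" if "U \<in> ?U" for U
    using that openQ_ballQ by auto
  obtain V where V: "V \<subseteq> ?U" "finite V" "?B \<subseteq> \<Union>V"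
    by (rule compactQ_cover[OF compactQ_ballQ[OF x] cov op])
  have "{y \<in> ?B. \<phi> y \<in> A} = ?B \<inter> \<Union>{W \<in> V. \<phi> ` W \<subseteq> A}"
  proof (intro equalityI subsetI)
    fix z assume z: "z \<in> {y \<in> ?B. \<phi> y \<in> A}"
    then obtain W where W: "W \<in> V" "z \<in> W" using V(3) by blast
    then obtain y where y: "W = ballQ p N y n" "y \<in> ?B" using V(1) by blast
    have "\<phi> w = \<phi> z" if "w \<in> W" for w
      using const[OF y(2)] that W(2) unfolding y(1) by metis
    then have "\<phi> ` W \<subseteq> A" using z by auto
    then show "z \<in> ?B \<inter> \<Union>{W \<in> V. \<phi> ` W \<subseteq> A}" using W z by blast
  qed auto
  moreover have "?B \<inter> \<Union>{W \<in> V. \<phi> ` W \<subseteq> A} \<in> sets (borelQ p N)"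
  proof (intro sets.Int sets.finite_Union ballQ_in_sets x)
    show "{W \<in> V. \<phi> ` W \<subseteq> A} \<subseteq> sets (borelQ p N)"
    proof
      fix W assume "W \<in> {W \<in> V. \<phi> ` W \<subseteq> A}"
      then obtain y where "W = ballQ p N y n" "y \<in> ?B" using V(1) by blast
      then show "W \<in> sets (borelQ p N)" using ballQ_in_sets[of y] ballQ_subset[of p N x k] by blast
    qed
  qed (use V in simp)
  moreover have "y \<in> ?B" if "y \<in> QpN p N" "\<phi> y \<in> A" "0 \<notin> A" for y
    using supp[of y] that by (cases "y \<in> ?B") auto
  then have "\<phi> -` A \<inter> QpN p N = {y \<in> ?B. \<phi> y \<in> A} \<union> (if 0 \<in> A then space (borelQ p N) - ?B else {})"
    using supp ballQ_subset[of p N x k] by auto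
  moreover have "space (borelQ p N) - ?B \<in> sets (borelQ p N)"
    using ballQ_in_sets[OF x] by (rule sets.compl_sets)
  ultimately show "\<phi> -` A \<inter> space (borelQ p N) \<in> sets (borelQ p N)"
    by (simp add: sets.Un)
qed simp

abbreviation halfline :: "nat \<Rightarrow> (nat \<Rightarrow> real) measure" where
  "halfline N \<equiv> PiM {..<N} (\<lambda>_. restrict_space lborel {0..})"

abbreviation digit_map :: "nat \<Rightarrow> nat \<Rightarrow> (nat \<Rightarrow> real) \<Rightarrow> nat \<Rightarrow> int \<Rightarrow> int" where
  "digit_map p N \<equiv> \<lambda>y c. if c < N then digitQ p (y c) else (\<lambda>_. 0)"

lemma space_halfline: "y \<in> space (halfline N) \<Longrightarrow> c < N \<Longrightarrow> 0 \<le> y c"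
  by (auto simp: space_PiM space_restrict_space)

lemma measurable_digit_map:
  assumes p: "1 < p"
  shows "digit_map p N \<in> measurable (halfline N) (borelQ p N)"
  unfolding borelQ_def
proof (rule measurable_measure_of)
  show "digit_map p N \<in> space (halfline N) \<rightarrow> QpN p N"
    using digitQ_in_Qp[OF p space_halfline] by (auto simp: QpN_def)
  fix B assume "B \<in> {ballQ p N x k |x k. x \<in> QpN p N}"
  then obtain x k where B: "B = ballQ p N x k" by auto
  have "digit_map p N y \<in> QpN p N" if "y \<in> space (halfline N)" for y
    using digitQ_in_Qp[OF p space_halfline[OF that]] by (auto simp: QpN_def)
  then have "digit_map p N -` B \<inter> space (halfline N)
      = {y \<in> space (halfline N). \<forall>c\<in>{..<N}. \<forall>i. i < k \<longrightarrow> digitQ p (y c) i = x c i}"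
    unfolding B by (auto simp: ballQ_def)
  also have "\<dots> \<in> sets (halfline N)"
  proof (intro sets.sets_Collect_finite_All sets.sets_Collect_countable_All)
    fix c i assume "c \<in> {..<N}"
    then have [measurable]: "(\<lambda>y. y c) \<in> borel_measurable (halfline N)"
      by (intro measurable_compose[OF measurable_component_singleton[of c]]) (auto intro!: measurable_restrict_space1)
    show "{y \<in> space (halfline N). i < k \<longrightarrow> digitQ p (y c) i = x c i} \<in> sets (halfline N)"
      unfolding digitQ_def by measurable
  qed auto
  finally show "digit_map p N -` B \<inter> space (halfline N) \<in> sets (halfline N)" .
qed (auto simp: ballQ_def)

lemma QpN_vanish:
  assumes "\<xi> \<in> QpN p N"
  obtains m where "\<forall>c<N. \<forall>i<m. \<xi> c i = 0"
proof -
  have "\<forall>c<N. \<exists>n. \<forall>i<n. \<xi> c i = 0" using assms by (auto simp: QpN_def Qp_def)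
  then obtain n where n: "\<And>c. c < N \<Longrightarrow> \<forall>i<n c. \<xi> c i = 0" by metis
  have "\<xi> c i = 0" if "c < N" "i < Min (insert 0 (n ` {..<N}))" for c i
    using n[OF that(1)] that by simp
  then show ?thesis using that by blast
qed

section \<open>Fourier transforms, Haar measures and dual measures of balls\<close>

text \<open>Both the character and the indicator of the ball factor over the coordinates, so after
  pulling back along the digit map the integral is a product of one-dimensional ones.\<close>

lemma fourierQ_ball:
  assumes p: "1 < p" and \<xi>: "\<xi> \<in> QpN p N"
  shows "fourierQ p N (indicator (ballQ p N zeroQ k)) \<xi>
    = of_real ((real p powr - real_of_int k) ^ N * indicator (ballQ p N zeroQ (- k)) \<xi>)"
proof -
  interpret product_sigma_finite "\<lambda>_::nat. restrict_space lborel {0::real..}"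
    by (intro product_sigma_finite.intro sigma_finite_measure_restrict_space)
      (auto intro: lborel.sigma_finite_measure_axioms)
  let ?B = "ballQ p N zeroQ k"
  let ?h = "\<lambda>x. chiQ p N \<xi> x * indicator ?B x :: complex"
  let ?g = "\<lambda>c t. if \<forall>i<k. digitQ p t i = 0 then add_char (pairQ p (\<xi> c) (digitQ p t)) else 0"
  obtain m where m: "\<forall>c<N. \<forall>i<m. \<xi> c i = 0" using QpN_vanish[OF \<xi>] .
  have "?h \<in> borel_measurable (borelQ p N)"
  \<comment> \<open>Digits of index \<open>- m\<close> or more meet \<open>\<xi>\<close> only in
    integer terms, so those below \<open>- m\<close> determine the character; those below
    \<open>k\<close> determine the indicator.\<close>
  proof (rule borel_measurable_locally_constant[of zeroQ _ _ k "max k (- m)"])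
    fix y z assume y: "y \<in> ?B" and z: "z \<in> ballQ p N y (max k (- m))"
    then have zB: "z \<in> ?B" by (auto simp: ballQ_def)
    have "add_char (pairQ p (\<xi> c) (z c)) = add_char (pairQ p (\<xi> c) (y c))" if c: "c < N" for c
    proof -
      let ?S = "\<lambda>b. \<Sum>(i,j)\<in>{m..< - k} \<times> {k..< - m}. real_of_int (\<xi> c i * b j) * real p powr real_of_int (i + j)"
      have "add_char (pairQ p (\<xi> c) (b c)) = add_char (?S (b c))" if "b \<in> ?B" for b
        using p m c that by (intro add_char_pairQ) (auto simp: ballQ_def zeroQ_def)
      moreover have "?S (z c) = ?S (y c)"
        using z c by (intro sum.cong) (auto simp: ballQ_def)
      ultimately show ?thesis using y zB by simp
    qed
    then have "chiQ p N \<xi> z = chiQ p N \<xi> y"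
      unfolding chiQ_eq_prod by (intro prod.cong) auto
    then show "?h z = ?h y" using y zB by simp
  qed (use zeroQ_in_QpN[OF p] in auto)
  then have "fourierQ p N (indicator ?B) \<xi> = (\<integral>y. ?h (digit_map p N y) \<partial>halfline N)"
    unfolding fourierQ_def haarQ_def using measurable_digit_map[OF p] by (intro integral_distr)
  also have "\<dots> = (\<integral>y. (\<Prod>c<N. ?g c (y c)) \<partial>halfline N)"
  proof (rule Bochner_Integration.integral_cong)
    fix y assume y: "y \<in> space (halfline N)"
    then have "digit_map p N y \<in> QpN p N"
      using measurable_space[OF measurable_digit_map[OF p]] by auto
    then have B: "digit_map p N y \<in> ?B \<longleftrightarrow> (\<forall>c<N. \<forall>i<k. digitQ p (y c) i = 0)"
      by (auto simp: ballQ_def zeroQ_def)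
    show "?h (digit_map p N y) = (\<Prod>c<N. ?g c (y c))"
    proof (cases "digit_map p N y \<in> ?B")
      case True
      then show ?thesis using B by (simp add: chiQ_eq_prod)
    next
      case False
      then obtain c where "c < N" "\<not> (\<forall>i<k. digitQ p (y c) i = 0)" using B by blast
      then have "(\<Prod>c<N. ?g c (y c)) = 0" by (intro prod_zero) auto
      then show ?thesis using False by simp
    qed
  qed simp
  also have "\<dots> = (\<Prod>c<N. \<integral>t. ?g c t \<partial>restrict_space lborel {0..})"
    using has_bochner_integral_digit_char[OF p] \<xi>
    by (intro product_integral_prod) (auto simp: has_bochner_integral_iff QpN_def)
  also have "\<dots> = (\<Prod>c<N. if \<forall>i< - k. \<xi> c i = 0 then of_real (real p powr - real_of_int k) else 0)"
    using has_bochner_integral_digit_char[OF p] \<xi>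
    by (intro prod.cong) (auto simp: has_bochner_integral_iff QpN_def)
  also have "\<dots> = of_real ((real p powr - real_of_int k) ^ N * indicator (ballQ p N zeroQ (- k)) \<xi>)"
  proof (cases "\<xi> \<in> ballQ p N zeroQ (- k)")
    case True
    then show ?thesis by (simp add: ballQ_def zeroQ_def)
  next
    case False
    then obtain c where "c < N" "\<not> (\<forall>i< - k. \<xi> c i = 0)" using \<xi> by (auto simp: ballQ_def zeroQ_def)
    then have "(\<Prod>c<N. if \<forall>i< - k. \<xi> c i = 0 then of_real (real p powr - real_of_int k) else 0 :: complex) = 0"
      by (intro prod_zero) auto
    then show ?thesis using False by simp
  qed
  finally show ?thesis .
qed

text \<open>The character of frequency 0 is constantly 1, so this is the Fourier transform of the
  indicator evaluated at 0.\<close>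

lemma emeasure_haarQ_ball:
  assumes p: "1 < p"
  shows "emeasure (haarQ p N) (ballQ p N zeroQ k) = ennreal ((real p powr - real_of_int k) ^ N)"
proof -
  let ?B = "ballQ p N zeroQ k"
  have "chiQ p N zeroQ x = 1" for x
    unfolding chiQ_def by (simp add: pairQ_def truncQ_def zeroQ_def Let_def)
  then have "fourierQ p N (indicator ?B) zeroQ = (\<integral>x. complex_of_real (indicator ?B x) \<partial>haarQ p N)"
    by (simp only: fourierQ_def of_real_indicator mult_1)
  also have "\<dots> = of_real (measure (haarQ p N) ?B)"
    by (simp only: integral_complex_of_real) (simp add: Int_absorb2 ballQ_subset)
  finally have m: "measure (haarQ p N) ?B = (real p powr - real_of_int k) ^ N"
    using fourierQ_ball[OF p zeroQ_in_QpN[OF p], of N k] centre_in_ballQ[OF zeroQ_in_QpN[OF p]]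
    by (simp del: of_real_power of_real_mult)
  \<comment> \<open>\<open>measure\<close> is 0 on sets of infinite measure, so its positive value
    here rules that out.\<close>
  then have "emeasure (haarQ p N) ?B \<noteq> \<infinity>"
    using p by (auto simp: measure_def)
  then show ?thesis using m by (simp add: emeasure_eq_ennreal_measure)
qed

text \<open>The origin is an intersection of balls whose measures p^(-kN) tend to 0 because
  \<open>N\<close> is positive. It has to be discarded, since the sign of \<open>f\<close> and the
  form of the kernel are controlled only away from it.\<close>

lemma AE_haarQ_nonzero:
  assumes p: "1 < p" and N: "0 < N"
  shows "AE x in haarQ p N. x \<noteq> zeroQ"
proof -
  have z: "{zeroQ} = (\<Inter>k::nat. ballQ p N zeroQ (int k))"
  proof (intro equalityI subsetI)
    fix x assume x: "x \<in> (\<Inter>k::nat. ballQ p N zeroQ (int k))"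
    have "x c i = 0" for c i
    proof -
      have "x \<in> ballQ p N zeroQ (int (nat (i + 1)))" using x by blast
      moreover have "i < int (nat (i + 1))" by simp
      ultimately show ?thesis by (cases "c < N") (simp_all add: ballQ_def zeroQ_def QpN_def)
    qed
    then show "x \<in> {zeroQ}" by (simp add: zeroQ_def fun_eq_iff)
  qed (use centre_in_ballQ zeroQ_in_QpN[OF p] in auto)
  have "{zeroQ} \<in> sets (haarQ p N)"
    unfolding z using ballQ_in_sets zeroQ_in_QpN[OF p] by (intro sets.countable_INT) auto
  moreover have "emeasure (haarQ p N) {zeroQ} = 0"
  proof -
    have "emeasure (haarQ p N) {zeroQ} \<le> ennreal ((1 / real p) ^ k)" for k
    proof -
      have "emeasure (haarQ p N) {zeroQ} \<le> emeasure (haarQ p N) (ballQ p N zeroQ (int k))"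
        unfolding z by (intro emeasure_mono) (use ballQ_in_sets zeroQ_in_QpN[OF p] in auto)
      also have "\<dots> = ennreal (((1 / real p) ^ k) ^ N)"
        using p by (simp add: emeasure_haarQ_ball powr_minus powr_realpow power_divide inverse_eq_divide)
      also have "\<dots> \<le> ennreal ((1 / real p) ^ k)"
        using p N power_decreasing[of 1 N "(1 / real p) ^ k"] by (intro ennreal_leI) (simp add: power_le_one)
      finally show ?thesis .
    qed
    moreover have "(\<lambda>k. ennreal ((1 / real p) ^ k)) \<longlonglongrightarrow> ennreal 0"
      using p by (intro tendsto_ennrealI LIMSEQ_power_zero) simp
    ultimately have "emeasure (haarQ p N) {zeroQ} \<le> ennreal 0"
      by (intro LIMSEQ_le_const) auto
    then show ?thesis by simp
  qed
  ultimately show ?thesis by (intro AE_I[of _ _ "{zeroQ}"]) auto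
qed

lemma testfunQ_ball:
  assumes p: "1 < p"
  shows "testfunQ p N (indicator (ballQ p N zeroQ k))"
  unfolding testfunQ_def
proof (intro conjI ballI)
  fix x
  show "\<exists>l. \<forall>y\<in>ballQ p N x l. indicator (ballQ p N zeroQ k) y = (indicator (ballQ p N zeroQ k) x :: complex)"
    if "x \<in> QpN p N"
    using that by (intro exI[of _ k]) (auto simp: ballQ_def indicator_def)
  show "\<exists>K. compactQ p N K \<and> {x \<in> QpN p N. indicator (ballQ p N zeroQ k) x \<noteq> (0::complex)} \<subseteq> K"
    using compactQ_ballQ[OF zeroQ_in_QpN[OF p]] by (intro exI[of _ "ballQ p N zeroQ k"]) (auto simp: indicator_def)
qed

text \<open>The duality is an identity of complex Bochner integrals. It passes to [0, infinity]
  because \<open>f\<close> is integrable on the compact ball and nonnegative almost everywhere, and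
  because regularity makes the dual ball have finite \<open>\<mu>\<close>-measure, so that
  \<open>measure\<close> does not fall back to 0.\<close>

lemma emeasure_dual_ball:
  assumes p: "1 < p" and N: "0 < N"
    and pos: "\<forall>x\<in>QpN p N - {zeroQ}. 0 \<le> f x"
    and loc: "locintQ p N f"
    and reg: "regular_borelQ p N \<mu>"
    and eq: "fourier_measure_eqQ p N f \<mu>"
  shows "emeasure \<mu> (ballQ p N zeroQ (- k))
    = ennreal ((real p powr real_of_int k) ^ N) * (\<integral>\<^sup>+x. ennreal (f x) * indicator (ballQ p N zeroQ k) x \<partial>haarQ p N)"
proof -
  let ?B = "ballQ p N zeroQ k" and ?D = "ballQ p N zeroQ (- k)"
  let ?v = "(real p powr - real_of_int k) ^ N"
  have sets: "sets \<mu> = sets (borelQ p N)" using reg by (simp add: regular_borelQ_def)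
  then have space: "space \<mu> = QpN p N" using sets_eq_imp_space_eq[OF sets] by simp
  have D: "?D \<in> sets \<mu>" using ballQ_in_sets zeroQ_in_QpN[OF p] sets by simp
  have fin: "emeasure \<mu> ?D < \<infinity>"
    using reg compactQ_ballQ[OF zeroQ_in_QpN[OF p]] unfolding regular_borelQ_def by blast
  have int: "integrable (haarQ p N) (\<lambda>x. indicator ?B x * f x)"
    using loc compactQ_ballQ[OF zeroQ_in_QpN[OF p]] by (auto simp: locintQ_def set_integrable_def)
  have "of_real (\<integral>x. indicator ?B x * f x \<partial>haarQ p N)
      = (\<integral>x. complex_of_real (f x) * indicator ?B x \<partial>haarQ p N)"
    by (simp flip: integral_complex_of_real add: mult.commute of_real_indicator)
  also have "\<dots> = (\<integral>\<xi>. fourierQ p N (indicator ?B) \<xi> \<partial>\<mu>)"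
    using eq testfunQ_ball[OF p] by (simp add: fourier_measure_eqQ_def)
  also have "\<dots> = (\<integral>\<xi>. complex_of_real (?v * indicator ?D \<xi>) \<partial>\<mu>)"
    by (rule Bochner_Integration.integral_cong) (simp_all only: space fourierQ_ball[OF p])
  also have "\<dots> = of_real (?v * measure \<mu> ?D)"
    using D sets.sets_into_space[OF D] by (simp only: integral_complex_of_real) (simp add: Int_absorb2)
  finally have I: "(\<integral>x. indicator ?B x * f x \<partial>haarQ p N) = ?v * measure \<mu> ?D"
    by (simp only: of_real_eq_iff)
  have "AE x in haarQ p N. 0 \<le> indicator ?B x * f x"
    using AE_haarQ_nonzero[OF p N] by (rule AE_mp) (use pos in \<open>auto intro!: AE_I2\<close>)
  then have "(\<integral>\<^sup>+x. ennreal (indicator ?B x * f x) \<partial>haarQ p N) = ennreal (?v * measure \<mu> ?D)"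
    using nn_integral_eq_integral[OF int] I by simp
  moreover have "(\<integral>\<^sup>+x. ennreal (f x) * indicator ?B x \<partial>haarQ p N) = (\<integral>\<^sup>+x. ennreal (indicator ?B x * f x) \<partial>haarQ p N)"
    by (rule nn_integral_cong) (simp add: indicator_def)
  moreover have "(real p powr real_of_int k) ^ N * ?v = 1"
    using p by (simp add: powr_minus flip: power_mult_distrib)
  ultimately have "ennreal ((real p powr real_of_int k) ^ N) * (\<integral>\<^sup>+x. ennreal (f x) * indicator ?B x \<partial>haarQ p N) = ennreal (measure \<mu> ?D)"
    by (simp flip: ennreal_mult mult.assoc)
  then show ?thesis using fin by (simp add: emeasure_eq_ennreal_measure)
qed

section \<open>Geometric series for the weight and the kernel\<close>

text \<open>The factor \<open>1 - q\<close> normalises the tail to exactly \<open>q ^ M\<close>; it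
  is the origin of 1 - p^(-s) in the kernel.\<close>

lemma sums_geometric_tail:
  fixes q :: real
  assumes "0 < q" "q < 1"
  shows "(\<lambda>j. if M \<le> j then (1 - q) * q ^ j else 0) sums q ^ M"
proof -
  have "(\<lambda>j. (1 - q) * q ^ M * q ^ j) sums ((1 - q) * q ^ M * (1 / (1 - q)))"
    using assms by (intro sums_mult geometric_sums) simp
  then have "(\<lambda>j. if M \<le> j + M then (1 - q) * q ^ (j + M) else 0) sums q ^ M"
    using assms by (simp add: power_add mult_ac)
  then show ?thesis
    by (subst (asm) sums_zero_iff_shift[where f = "\<lambda>j. if M \<le> j then (1 - q) * q ^ j else 0"]) auto
qed

text \<open>Let p^M be the value of the maximum. Then \<open>M\<close> is the least \<open>j\<close>
  whose ball contains \<open>\<xi>\<close>, so the indicators cut the series down to its tail from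
  \<open>M\<close>, with sum p^(-Ms).\<close>

lemma weight_eq_suminf:
  assumes p: "1 < p" and s: "0 < s" and \<xi>: "\<xi> \<in> QpN p N"
  shows "ennreal (1 / max 1 (normQ p N \<xi>) powr s)
    = (\<Sum>j. ennreal ((1 - real p powr - s) * (real p powr - s) ^ j) * indicator (ballQ p N zeroQ (- int j)) \<xi>)"
proof -
  define q where "q = real p powr - s"
  have q: "0 < q" "q < 1" using p s by (auto simp: q_def powr_less_one)
  have "\<exists>M. max 1 (normQ p N \<xi>) = real p ^ M \<and> (\<forall>j. \<xi> \<in> ballQ p N zeroQ (- int j) \<longleftrightarrow> M \<le> j)"
  proof (cases "\<xi> \<in> ballQ p N zeroQ 0")
    case True
    then have "normQ p N \<xi> \<le> 1" using normQ_le_iff[OF p \<xi>, of 0] p by simp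
    moreover have "\<xi> \<in> ballQ p N zeroQ (- int j)" for j
      using True ballQ_mono[of "- int j" 0] by auto
    ultimately show ?thesis by (intro exI[of _ 0]) auto
  next
    case False
    then have "\<xi> \<noteq> zeroQ" using centre_in_ballQ[OF zeroQ_in_QpN[OF p]] by auto
    then obtain m where m: "normQ p N \<xi> = real p powr - real_of_int m"
      using normQ_cases[OF p \<xi>] by blast
    have mem: "\<xi> \<in> ballQ p N zeroQ k \<longleftrightarrow> k \<le> m" for k
      using normQ_le_iff[OF p \<xi>, of k] p by (simp add: m)
    then have "m < 0" using False by simp
    then have "normQ p N \<xi> = real p ^ nat (- m)"
      using p m powr_real_of_int[of "real p" "- m"] by simp
    moreover have "1 \<le> real p ^ nat (- m)" using p by simp
    moreover have "\<xi> \<in> ballQ p N zeroQ (- int j) \<longleftrightarrow> nat (- m) \<le> j" for j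
      using \<open>m < 0\<close> unfolding mem by linarith
    ultimately show ?thesis by (intro exI[of _ "nat (- m)"]) (simp add: max_def)
  qed
  then obtain M where M: "max 1 (normQ p N \<xi>) = real p ^ M"
    "\<And>j. \<xi> \<in> ballQ p N zeroQ (- int j) \<longleftrightarrow> M \<le> j" by blast
  have "1 / max 1 (normQ p N \<xi>) powr s = q ^ M"
  proof -
    have "(real p ^ M) powr s = real p powr (real M * s)"
      using p by (simp add: powr_powr flip: powr_realpow)
    moreover have "q ^ M = real p powr (- (real M * s))"
      using p by (simp add: q_def powr_power mult.commute)
    ultimately show ?thesis by (simp add: M(1) powr_minus_divide)
  qed
  moreover have "(\<Sum>j. ennreal ((1 - q) * q ^ j) * indicator (ballQ p N zeroQ (- int j)) \<xi>)
      = (\<Sum>j. ennreal (if M \<le> j then (1 - q) * q ^ j else 0))"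
    by (rule suminf_cong) (simp add: M(2) indicator_def)
  moreover have "\<dots> = ennreal (q ^ M)"
    using q by (intro suminf_ennreal_eq sums_geometric_tail) auto
  ultimately show ?thesis by (simp only: q_def)
qed

text \<open>With \<rho> = p^(N-s), the coefficients become (1-q) \<rho>^j, and on the sphere of
  radius p^(-M) just the indices \<open>j <= M\<close> survive. For s = N the ratio is 1 and the M+1
  equal terms give the logarithm of p / ||x||. Otherwise (\<rho>^(M+1) - 1)/(\<rho> - 1), divided
  through by \<rho>, is the quotient in powers of p^(s-N). Outside the unit ball both sides are
  0.\<close>

lemma kernel_eq_suminf:
  assumes p: "1 < p" and s: "0 < s" and x: "x \<in> QpN p N" "x \<noteq> zeroQ" and y: "0 \<le> y"
  defines "W \<equiv> if s \<noteq> real N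
      then (1 - real p powr - s) / (1 - real p powr (s - real N)) * (normQ p N x powr (s - real N) - real p powr (s - real N))
      else (1 - real p powr - real N) * log (real p) (real p / normQ p N x)"
  shows "ennreal (W * y) * indicator (ballQ p N zeroQ 0) x
    = (\<Sum>j. ennreal ((1 - real p powr - s) * (real p powr - s) ^ j) * (ennreal ((real p powr real_of_int (int j)) ^ N)
        * (ennreal y * indicator (ballQ p N zeroQ (int j)) x)))"
    (is "_ = (\<Sum>j. ?t j)")
proof -
  define q where "q = real p powr - s"
  define \<rho> where "\<rho> = real p powr (real N - s)"
  have q: "0 < q" "q < 1" using p s by (auto simp: q_def powr_less_one)
  have \<rho>: "0 < \<rho>" using p by (simp add: \<rho>_def)
  obtain m where m: "normQ p N x = real p powr - real_of_int m"
    using normQ_cases[OF p x] by blast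
  have mem: "x \<in> ballQ p N zeroQ k \<longleftrightarrow> k \<le> m" for k
    using normQ_le_iff[OF p x(1), of k] p by (simp add: m)
  show ?thesis
  proof (cases "0 \<le> m")
    case False
    then have "?t j = 0" for j using mem by (simp add: indicator_def)
    then show ?thesis using False mem by (simp add: indicator_def)
  next
    case True
    define M where "M = nat m"
    have mM: "m = int M" using True by (simp add: M_def)
    have summand: "?t j = (if j \<le> M then ennreal ((1 - q) * \<rho> ^ j * y) else 0)" for j
    proof -
      have "q * real p ^ N = \<rho>"
        using p by (simp add: q_def \<rho>_def powr_minus powr_diff powr_realpow divide_inverse mult.commute)
      then have "q ^ j * (real p ^ N) ^ j = \<rho> ^ j"
        by (simp flip: power_mult_distrib)
      moreover have "(real p powr real_of_int (int j)) ^ N = (real p ^ N) ^ j"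
        using p by (simp add: powr_realpow mult.commute flip: power_mult)
      ultimately have split: "(1 - q) * q ^ j * ((real p powr real_of_int (int j)) ^ N * y) = (1 - q) * \<rho> ^ j * y"
        by (simp add: mult.assoc[symmetric])
      have "ennreal ((1 - q) * \<rho> ^ j * y)
          = ennreal ((1 - q) * q ^ j) * (ennreal ((real p powr real_of_int (int j)) ^ N) * ennreal y)"
        unfolding split[symmetric] using q y by (simp add: ennreal_mult del: of_int_of_nat_eq)
      then show ?thesis
        by (simp add: mem mM q_def[symmetric] indicator_def del: of_int_of_nat_eq)
    qed
    have "(\<Sum>j. ?t j) = (\<Sum>j\<in>{..M}. ?t j)"
      by (rule suminf_finite) (simp_all only: summand finite_atMost atMost_iff if_False)
    also have "\<dots> = (\<Sum>j\<in>{..M}. ennreal ((1 - q) * \<rho> ^ j * y))"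
      by (rule sum.cong) (simp_all only: summand atMost_iff if_True)
    also have "\<dots> = ennreal (\<Sum>j\<in>{..M}. (1 - q) * \<rho> ^ j * y)"
      using q \<rho> y by (intro sum_ennreal) auto
    also have "(\<Sum>j\<in>{..M}. (1 - q) * \<rho> ^ j * y) = (1 - q) * (\<Sum>j<Suc M. \<rho> ^ j) * y"
      by (simp add: sum_distrib_left sum_distrib_right lessThan_Suc_atMost)
    also have "(1 - q) * (\<Sum>j<Suc M. \<rho> ^ j) = W"
    proof (cases "s = real N")
      case True
      have "log (real p) (real p / normQ p N x) = 1 + real M"
        using p by (simp add: m mM powr_minus powr_realpow divide_inverse log_mult log_nat_power)
      then show ?thesis using True p by (simp add: W_def q_def \<rho>_def)
    next
      case False
      then have "\<rho> \<noteq> 1" using p by (simp add: \<rho>_def powr_eq_one_iff_gen)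
      moreover have "real p powr (s - real N) = 1 / \<rho>"
        using p by (simp add: \<rho>_def powr_diff)
      moreover have "normQ p N x powr (s - real N) = \<rho> ^ M"
      proof -
        have "normQ p N x powr (s - real N) = real p powr ((real N - s) * real M)"
          by (simp add: m mM powr_powr algebra_simps)
        also have "\<dots> = \<rho> ^ M" using p by (simp add: \<rho>_def powr_power mult.commute)
        finally show ?thesis .
      qed
      ultimately have "W = (1 - q) / (1 - 1 / \<rho>) * (\<rho> ^ M - 1 / \<rho>)" "\<rho> \<noteq> 1"
        using False by (simp_all add: W_def q_def)
      moreover have "1 - 1 / \<rho> = (\<rho> - 1) / \<rho>" "\<rho> ^ M - 1 / \<rho> = (\<rho> ^ Suc M - 1) / \<rho>"
        using \<rho> by (simp_all add: field_simps)
      ultimately show ?thesis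
        using \<rho> geometric_sum[of \<rho> "Suc M"] by (simp del: sum.lessThan_Suc power_Suc)
    qed
    finally show ?thesis using mem mM by (simp add: indicator_def)
  qed
qed

section \<open>The equivalence\<close>

lemma dimension_0: "1 < p \<Longrightarrow> QpN p 0 = {zeroQ}"
  by (auto simp: QpN_def zeroQ_def fun_eq_iff)

theorem theorem4:
  fixes p N d :: nat and \<beta> :: real
    and f :: "(nat \<Rightarrow> int \<Rightarrow> int) \<Rightarrow> real"
    and \<mu> :: "(nat \<Rightarrow> int \<Rightarrow> int) measure"
  assumes "prime p"
    and "\<forall>x\<in>QpN p N - {zeroQ}. 0 \<le> f x"
    and "contQ p N f"
    and "locintQ p N f"
    and "posdefQ p N f"
    and "regular_borelQ p N \<mu>"
    and "fourier_measure_eqQ p N f \<mu>"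
    and "1 \<le> d" and "0 < \<beta>"
  shows "(\<integral>\<^sup>+ \<xi>. ennreal (1 / max 1 (normQ p N \<xi>) powr (real d * \<beta>)) \<partial>\<mu>) < \<infinity> \<longleftrightarrow>
    (if real d * \<beta> \<noteq> real N then
       (\<integral>\<^sup>+ x. ennreal ((1 - real p powr (- (real d * \<beta>))) / (1 - real p powr (real d * \<beta> - real N))
            * (normQ p N x powr (real d * \<beta> - real N) - real p powr (real d * \<beta> - real N)) * f x)
          * indicator (ballQ p N zeroQ 0) x \<partial>haarQ p N) < \<infinity>
     else
       (\<integral>\<^sup>+ x. ennreal ((1 - real p powr (- real N)) * log (real p) (real p / normQ p N x) * f x)
          * indicator (ballQ p N zeroQ 0) x \<partial>haarQ p N) < \<infinity>)"
proof -
  define s where "s = real d * \<beta>"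
  have s: "0 < s" using assms by (simp add: s_def)
  have p: "1 < p" using assms(1) by (rule prime_gt_1_nat)
  have sets: "sets \<mu> = sets (borelQ p N)" using assms(6) by (simp add: regular_borelQ_def)
  have space: "space \<mu> = QpN p N" using sets_eq_imp_space_eq[OF sets] by simp
  have B_sets: "ballQ p N zeroQ k \<in> sets (borelQ p N)" for k
    using ballQ_in_sets zeroQ_in_QpN[OF p] by simp
  have B_fin: "emeasure \<mu> (ballQ p N zeroQ k) < \<infinity>" for k
    using assms(6) compactQ_ballQ[OF zeroQ_in_QpN[OF p]] unfolding regular_borelQ_def by blast
  define W where "W x = (if s \<noteq> real N
      then (1 - real p powr - s) / (1 - real p powr (s - real N)) * (normQ p N x powr (s - real N) - real p powr (s - real N))
      else (1 - real p powr - real N) * log (real p) (real p / normQ p N x))" for x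
  let ?L = "\<integral>\<^sup>+ \<xi>. ennreal (1 / max 1 (normQ p N \<xi>) powr s) \<partial>\<mu>"
  let ?R = "\<integral>\<^sup>+ x. ennreal (W x * f x) * indicator (ballQ p N zeroQ 0) x \<partial>haarQ p N"
  have "?L < \<infinity> \<longleftrightarrow> ?R < \<infinity>"
  proof (cases "N = 0")
    \<comment> \<open>The space is a single point of Haar measure 1, so the origin is not null and
      the value of \<open>f\<close> there is arbitrary. Both integrands are constant and both
      measures finite.\<close>
    case True
    have B0: "QpN p N = ballQ p N zeroQ 0"
      using True by (auto simp: ballQ_def)
    have "?L = (\<integral>\<^sup>+ \<xi>. ennreal (1 / max 1 (normQ p N zeroQ) powr s) \<partial>\<mu>)"
      using True dimension_0[OF p] by (intro nn_integral_cong) (simp add: space)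
    then have "?L < \<infinity>"
      using B_fin[of 0] by (simp add: space B0 ennreal_mult_less_top)
    moreover have "?R = (\<integral>\<^sup>+ x. ennreal (W zeroQ * f zeroQ) * indicator (ballQ p N zeroQ 0) zeroQ \<partial>haarQ p N)"
      using True dimension_0[OF p] by (intro nn_integral_cong) simp
    then have "?R < \<infinity>"
      using emeasure_haarQ_ball[OF p, of N 0] by (simp add: B0 ennreal_mult_less_top indicator_def)
    ultimately show ?thesis by simp
  next
    case False
    then have N: "0 < N" by simp
    let ?c = "\<lambda>j. ennreal ((1 - real p powr - s) * (real p powr - s) ^ j)"
    \<comment> \<open>Measurability for the exchange of sum and integral is drawn from the
      integrability of \<open>f\<close> over compact balls.\<close>
    have fB [measurable]: "(\<lambda>x. ennreal (f x) * indicator (ballQ p N zeroQ k) x) \<in> borel_measurable (haarQ p N)" for k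
    proof -
      have "integrable (haarQ p N) (\<lambda>x. indicator (ballQ p N zeroQ k) x *\<^sub>R f x)"
        using assms(4) compactQ_ballQ[OF zeroQ_in_QpN[OF p]] unfolding locintQ_def set_integrable_def by blast
      then have "(\<lambda>x. ennreal (indicator (ballQ p N zeroQ k) x *\<^sub>R f x)) \<in> borel_measurable (haarQ p N)"
        by (rule measurable_compose[OF borel_measurable_integrable measurable_ennreal])
      moreover have "ennreal (indicator (ballQ p N zeroQ k) x *\<^sub>R f x) = ennreal (f x) * indicator (ballQ p N zeroQ k) x" for x
        by (simp add: indicator_def)
      ultimately show ?thesis by simp
    qed
    have "?L = (\<integral>\<^sup>+ \<xi>. (\<Sum>j. ?c j * indicator (ballQ p N zeroQ (- int j)) \<xi>) \<partial>\<mu>)"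
      by (rule nn_integral_cong) (simp add: weight_eq_suminf[OF p s] space)
    also have "\<dots> = (\<Sum>j. \<integral>\<^sup>+ \<xi>. ?c j * indicator (ballQ p N zeroQ (- int j)) \<xi> \<partial>\<mu>)"
      using B_sets sets by (intro nn_integral_suminf) auto
    also have "\<dots> = (\<Sum>j. ?c j * emeasure \<mu> (ballQ p N zeroQ (- int j)))"
      using B_sets sets by (intro suminf_cong nn_integral_cmult_indicator) auto
    also have "\<dots> = (\<Sum>j. ?c j * (ennreal ((real p powr real_of_int (int j)) ^ N)
        * (\<integral>\<^sup>+x. ennreal (f x) * indicator (ballQ p N zeroQ (int j)) x \<partial>haarQ p N)))"
      by (simp only: emeasure_dual_ball[OF p N assms(2,4,6,7)])
    also have "\<dots> = (\<Sum>j. \<integral>\<^sup>+x. ?c j * (ennreal ((real p powr real_of_int (int j)) ^ N)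
        * (ennreal (f x) * indicator (ballQ p N zeroQ (int j)) x)) \<partial>haarQ p N)"
      by (intro suminf_cong) (simp add: nn_integral_cmult)
    also have "\<dots> = (\<integral>\<^sup>+x. (\<Sum>j. ?c j * (ennreal ((real p powr real_of_int (int j)) ^ N)
        * (ennreal (f x) * indicator (ballQ p N zeroQ (int j)) x))) \<partial>haarQ p N)"
      by (intro nn_integral_suminf[symmetric]) measurable
    also have "\<dots> = ?R"
    proof (rule nn_integral_cong_AE, rule AE_mp[OF AE_haarQ_nonzero[OF p N]], intro AE_I2 impI)
      fix x assume "x \<in> space (haarQ p N)" "x \<noteq> zeroQ"
      then show "(\<Sum>j. ?c j * (ennreal ((real p powr real_of_int (int j)) ^ N)
          * (ennreal (f x) * indicator (ballQ p N zeroQ (int j)) x))) = ennreal (W x * f x) * indicator (ballQ p N zeroQ 0) x"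
        unfolding W_def using assms(2) by (intro kernel_eq_suminf[OF p s, symmetric]) auto
    qed
    finally show ?thesis by simp
  qed
  then show ?thesis unfolding W_def s_def by (cases "real d * \<beta> = real N") simp_all
qed

end
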